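(* (Second mean value theorem) Let $f\in\mathcal{A}_C$ and let $g:\overline{\mathbb{R}}\to\mathbb{R}$ be monotonic. Then $$\int_{-\infty}^\infty fg=g(-\infty)\int_{-\infty}^\xi f+g(\infty)\int_\xi^\infty f$$ for some $\xi\in\overline{\mathbb{R}}$.
   Context: $\mathcal{D}=C_c^\infty(\mathbb{R})$ (real-valued), $\mathcal{D}'$ is the space of distributions, $\langle T',\phi\rangle=-\langle T,\phi'\rangle$; functions are identified with distributions in the usual way. $\overline{\mathbb{R}}=[-\infty,\infty]$. $C^0(\overline{\mathbb{R}})$ is the set of continuous real functions $F$ on $\mathbb{R}$ with real limits at $\pm\infty$, extended by $F(\pm\infty)=\lim_{\pm\infty}F$. $\mathcal{B}_C=\{F\in C^0(\overline{\mathbb{R}}): F(-\infty)=0\}$ and $\mathcal{A}_C=\{f\in\mathcal{D}': f=F' \text{ for some } F\in\mathcal{B}_C\}$; the primitive $F\in\mathcal{B}_C$ of $f\in\mathcal{A}_C$ is unique and $\int_a^b f=F(b)-F(a)$ for $a,b\in\overline{\mathbb{R}}$. For $f\in\mathcal{A}_C$ with primitive $F$ and $g:\overline{\mathbb{R}}\to\mathbb{R}$ of bounded variation on $\overline{\mathbb{R}}$ (in particular for $g$ monotonic and real-valued on $\overline{\mathbb{R}}$), $\int_{-\infty}^\infty fg:=F(\infty)g(\infty)-\int_{-\infty}^\infty F\,dg$, where the last integral is the Riemann–Stieltjes integral over $\overline{\mathbb{R}}$ (including contributions of jumps of $g$ at $\pm\infty$): $$\int_{-\infty}^\infty F\,dg=\lim_{A\to-\infty,\,B\to\infty}\int_A^B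 F\,dg+F(\infty)\bigl[g(\infty)-\lim_{x\to\infty}g(x)\bigr]+F(-\infty)\bigl[\lim_{x\to-\infty}g(x)-g(-\infty)\bigr].$$ *)

theory Defs
  imports "HOL-Analysis.Analysis"
begin

section \<open>Test functions and distributions on the real line\<close>

definition fun_support :: "(real \<Rightarrow> real) \<Rightarrow> real set" where
  "fun_support \<phi> = closure {x. \<phi> x \<noteq> 0}"

definition test_functions :: "(real \<Rightarrow> real) set" where
  "test_functions =
     {\<phi>. (\<forall>n x. (deriv ^^ n) \<phi> field_differentiable (at x)) \<and> compact (fun_support \<phi>)}"

definition test_converges :: "(nat \<Rightarrow> real \<Rightarrow> real) \<Rightarrow> (real \<Rightarrow> real) \<Rightarrow> bool" where
  "test_converges \<phi>s \<phi> \<longleftrightarrow>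
     (\<exists>K. compact K \<and> (\<forall>n. fun_support (\<phi>s n) \<subseteq> K)) \<and>
     (\<forall>m. uniform_limit UNIV (\<lambda>n. (deriv ^^ m) (\<phi>s n)) ((deriv ^^ m) \<phi>) sequentially)"

text \<open>
  A distribution is a functional on the test functions. Its value at any other function is fixed
  by membership in \<^const>\<open>extensional\<close>, so that equality of distributions is equality in HOL.
  For linear functionals on the test functions, continuity in the usual inductive limit topology
  is equivalent to sequential continuity.
\<close>

definition distributions :: "((real \<Rightarrow> real) \<Rightarrow> real) set" where
  "distributions =
     {T \<in> extensional test_functions.
        (\<forall>\<phi>\<in>test_functions. \<forall>\<psi>\<in>test_functions. \<forall>a b.
           T (\<lambda>x. a * \<phi> x + b * \<psi> x) = a * T \<phi> + b * T \<psi>) \<and>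
        (\<forall>\<phi>s \<phi>. (\<forall>n. \<phi>s n \<in> test_functions) \<longrightarrow> \<phi> \<in> test_functions \<longrightarrow>
           test_converges \<phi>s \<phi> \<longrightarrow> (\<lambda>n. T (\<phi>s n)) \<longlonglongrightarrow> T \<phi>)}"

definition distribution_of_fun :: "(real \<Rightarrow> real) \<Rightarrow> (real \<Rightarrow> real) \<Rightarrow> real" where
  "distribution_of_fun F = restrict (\<lambda>\<phi>. LINT x|lborel. F x * \<phi> x) test_functions"

definition distribution_deriv ::
    "((real \<Rightarrow> real) \<Rightarrow> real) \<Rightarrow> (real \<Rightarrow> real) \<Rightarrow> real" where
  "distribution_deriv T = restrict (\<lambda>\<phi>. - T (deriv \<phi>)) test_functions"

section \<open>Integrable distributions\<close>

definition C0_ext :: "(ereal \<Rightarrow> real) set" where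
  "C0_ext =
     {F. continuous_on UNIV (\<lambda>x::real. F (ereal x)) \<and>
         ((\<lambda>x::real. F (ereal x)) \<longlongrightarrow> F \<infinity>) at_top \<and>
         ((\<lambda>x::real. F (ereal x)) \<longlongrightarrow> F (-\<infinity>)) at_bot}"

definition B_C :: "(ereal \<Rightarrow> real) set" where
  "B_C = {F \<in> C0_ext. F (-\<infinity>) = 0}"

definition is_primitive :: "(ereal \<Rightarrow> real) \<Rightarrow> ((real \<Rightarrow> real) \<Rightarrow> real) \<Rightarrow> bool" where
  "is_primitive F f \<longleftrightarrow>
     F \<in> B_C \<and> f = distribution_deriv (distribution_of_fun (\<lambda>x. F (ereal x)))"

definition A_C :: "((real \<Rightarrow> real) \<Rightarrow> real) set" where
  "A_C = {f \<in> distributions. \<exists>F. is_primitive F f}"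

definition primitive :: "((real \<Rightarrow> real) \<Rightarrow> real) \<Rightarrow> ereal \<Rightarrow> real" where
  "primitive f = (THE F. is_primitive F f)"

definition AC_integral :: "((real \<Rightarrow> real) \<Rightarrow> real) \<Rightarrow> ereal \<Rightarrow> ereal \<Rightarrow> real" where
  "AC_integral f a b = primitive f b - primitive f a"

section \<open>Riemann--Stieltjes integrals\<close>

text \<open>
  Each cell \<open>k\<close> of a tagged division of a real interval is a closed interval
  \<open>{Inf k..Sup k}\<close>. Using only gauges of constant radius makes this the Riemann (mesh)
  notion of limit and not the Henstock--Kurzweil one.
\<close>

definition has_RS_integral ::
    "(real \<Rightarrow> real) \<Rightarrow> (real \<Rightarrow> real) \<Rightarrow> real \<Rightarrow> real \<Rightarrow> real \<Rightarrow> bool" where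
  "has_RS_integral F g a b I \<longleftrightarrow>
     (\<forall>\<epsilon>>0. \<exists>\<delta>>0. \<forall>p. p tagged_division_of {a..b} \<and> (\<lambda>x. ball x \<delta>) fine p \<longrightarrow>
        \<bar>(\<Sum>(x, k)\<in>p. F x * (g (Sup k) - g (Inf k))) - I\<bar> < \<epsilon>)"

definition RS_integral :: "(real \<Rightarrow> real) \<Rightarrow> (real \<Rightarrow> real) \<Rightarrow> real \<Rightarrow> real \<Rightarrow> real" where
  "RS_integral F g a b = (THE I. has_RS_integral F g a b I)"

definition RS_integral_ext :: "(ereal \<Rightarrow> real) \<Rightarrow> (ereal \<Rightarrow> real) \<Rightarrow> real" where
  "RS_integral_ext F g =
     Lim (at_bot \<times>\<^sub>F at_top)
       (\<lambda>(A, B). RS_integral (\<lambda>x. F (ereal x)) (\<lambda>x. g (ereal x)) A B)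
     + F \<infinity> * (g \<infinity> - Lim at_top (\<lambda>x::real. g (ereal x)))
     + F (-\<infinity>) * (Lim at_bot (\<lambda>x::real. g (ereal x)) - g (-\<infinity>))"

definition AC_integral_mult :: "((real \<Rightarrow> real) \<Rightarrow> real) \<Rightarrow> (ereal \<Rightarrow> real) \<Rightarrow> real" where
  "AC_integral_mult f g = primitive f \<infinity> * g \<infinity> - RS_integral_ext (primitive f) g"

end

theory Submission
  imports Defs
begin

text \<open>
  Let \<open>F\<close> be the primitive of \<open>f\<close>. For increasing \<open>g\<close>, the Riemann--Stieltjes integral of \<open>F\<close>
  against \<open>g\<close> over the extended line, jumps at infinity included, lies between
  \<open>min F * (g \<infinity> - g (-\<infinity>))\<close> and \<open>max F * (g \<infinity> - g (-\<infinity>))\<close>. By connectedness of the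
  extended line it equals \<open>F \<xi> * (g \<infinity> - g (-\<infinity>))\<close> for some \<open>\<xi>\<close>, and since \<open>F (-\<infinity>) = 0\<close> the
  definition of the integral of \<open>f g\<close> turns this into the claim. Decreasing \<open>g\<close> is handled by \<open>- g\<close>.
  The definite description of the primitive is meaningful because a continuous function with
  vanishing distributional derivative is constant.
\<close>

section \<open>Smooth bump functions\<close>

text \<open>\<open>flat 0\<close> is the classical exp(-1/x) cutoff. The extra factor
  \<open>1 / x ^ k\<close> makes the family closed under differentiation up to linear combinations,
  so one derivative rule covers all orders.\<close>

definition flat :: "nat \<Rightarrow> real \<Rightarrow> real" where
  "flat k x = (if x \<le> 0 then 0 else exp (- (1 / x)) / x ^ k)"

lemma flat_nonneg: "0 \<le> flat k x"
  by (simp add: flat_def)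

lemma flat_pos_iff: "0 < flat k x \<longleftrightarrow> 0 < x"
  by (simp add: flat_def)

text \<open>On the right of 0 the substitution y = 1/x turns \<open>flat k x\<close> into y^k / exp
  y as y tends to infinity.\<close>

lemma flat_tendsto_0: "(flat k \<longlongrightarrow> 0) (at 0)"
proof (rule filterlim_split_at)
  have "eventually (\<lambda>x. 0 = flat k x) (at_left 0)"
    unfolding eventually_at by (rule exI[of _ 1]) (simp add: flat_def)
  then show "(flat k \<longlongrightarrow> 0) (at_left 0)"
    by (rule Lim_transform_eventually[OF tendsto_const])
  have "((\<lambda>x::real. inverse x ^ k / exp (inverse x)) \<longlongrightarrow> 0) (at_right 0)"
    using filterlim_compose[OF tendsto_power_div_exp_0 filterlim_inverse_at_top_right] .
  moreover have "eventually (\<lambda>x::real. inverse x ^ k / exp (inverse x) = flat k x) (at_right 0)"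
    unfolding eventually_at
    by (rule exI[of _ 1]) (simp add: flat_def exp_minus field_simps)
  ultimately show "(flat k \<longlongrightarrow> 0) (at_right 0)"
    by (rule Lim_transform_eventually)
qed

lemma flat_has_real_derivative:
  "(flat k has_real_derivative - real k * flat (Suc k) x + flat (k + 2) x) (at x)"
proof -
  consider "x < 0" | "x = 0" | "0 < x"
    by linarith
  then show ?thesis
  proof cases
    case 1
    have "((\<lambda>_. 0) has_real_derivative 0) (at x)"
      by simp
    then have "(flat k has_real_derivative 0) (at x)"
      by (rule has_field_derivative_transform_within_open[where S = "{..<0}"])
        (use 1 in \<open>auto simp: flat_def\<close>)
    then show ?thesis
      using 1 by (simp add: flat_def)
  next
    case 2
    \<comment> \<open>The difference quotient of \<open>flat k\<close> at 0 is again a member of the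
      family, so its limit is already known.\<close>
    have quotient: "(\<lambda>h. (flat k (0 + h) - flat k 0) / h) = flat (Suc k)"
      by (auto simp: flat_def fun_eq_iff)
    have "(flat k has_real_derivative 0) (at 0)"
      unfolding DERIV_def quotient by (rule flat_tendsto_0)
    then show ?thesis
      using 2 by (simp add: flat_def)
  next
    case 3
    have "((\<lambda>x. exp (- (1 / x)) / x ^ k) has_real_derivative
        - real k * flat (Suc k) x + flat (k + 2) x) (at x)"
      by (cases k; rule derivative_eq_intros refl | use 3 in \<open>simp add: flat_def field_simps\<close>)+
    then show ?thesis
      by (rule has_field_derivative_transform_within_open[where S = "{0<..}"])
        (use 3 in \<open>auto simp: flat_def\<close>)
  qed
qed

text \<open>A class of functions that contains all bumps used below and is mapped into itself by
  \<open>deriv\<close>. Smoothness then follows by iteration, without formulas for higher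
  derivatives.\<close>

inductive flat_algebra :: "(real \<Rightarrow> real) \<Rightarrow> bool" where
  flat: "flat_algebra (\<lambda>x. flat k (a * x + b))"
| const: "flat_algebra (\<lambda>_. a)"
| add: "flat_algebra f \<Longrightarrow> flat_algebra g \<Longrightarrow> flat_algebra (\<lambda>x. f x + g x)"
| mult: "flat_algebra f \<Longrightarrow> flat_algebra g \<Longrightarrow> flat_algebra (\<lambda>x. f x * g x)"

lemma flat_algebra_deriv:
  assumes "flat_algebra f"
  shows "\<exists>f'. flat_algebra f' \<and> (\<forall>x. (f has_real_derivative f' x) (at x))"
  using assms
proof induction
  case (flat k a b)
  let ?f' = "\<lambda>x. (- real k * flat (Suc k) (a * x + b) + flat (k + 2) (a * x + b)) * a"
  have "flat_algebra ?f'"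
    by (intro flat_algebra.intros)
  moreover have "((\<lambda>x. flat k (a * x + b)) has_real_derivative ?f' x) (at x)" for x
  proof (rule DERIV_chain2[OF flat_has_real_derivative])
    show "((\<lambda>x. a * x + b) has_real_derivative a) (at x)"
      by (auto intro!: derivative_eq_intros)
  qed
  ultimately show ?case by blast
next
  case (const a)
  show ?case
    by (rule exI[of _ "\<lambda>_. 0"]) (simp add: flat_algebra.const)
next
  case (add f g)
  then obtain f' g' where "flat_algebra f'" "flat_algebra g'"
    "\<And>x. (f has_real_derivative f' x) (at x)" "\<And>x. (g has_real_derivative g' x) (at x)"
    by blast
  then show ?case
    by (intro exI[of _ "\<lambda>x. f' x + g' x"]) (auto intro: flat_algebra.add DERIV_add)
next
  case (mult f g)
  then obtain f' g' where *: "flat_algebra f'" "flat_algebra g'"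
    "\<And>x. (f has_real_derivative f' x) (at x)" "\<And>x. (g has_real_derivative g' x) (at x)"
    by blast
  have "flat_algebra (\<lambda>x. f' x * g x + g' x * f x)"
    by (intro flat_algebra.add flat_algebra.mult * mult.hyps)
  then show ?case
    using * by (intro exI[of _ "\<lambda>x. f' x * g x + g' x * f x"]) (auto intro: DERIV_mult)
qed

lemma flat_algebra_smooth:
  assumes "flat_algebra f"
  shows "(deriv ^^ n) f field_differentiable (at x)"
proof -
  have "flat_algebra (deriv g)" if g: "flat_algebra g" for g
  proof -
    obtain g' where "flat_algebra g'" "\<And>x. (g has_real_derivative g' x) (at x)"
      using flat_algebra_deriv[OF g] by blast
    moreover from this have "deriv g = g'"
      by (intro ext DERIV_imp_deriv)
    ultimately show ?thesis by simp
  qed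
  then have "flat_algebra ((deriv ^^ n) f)"
    using assms by (induction n) auto
  then show ?thesis
    using flat_algebra_deriv field_differentiable_def by blast
qed

lemma flat_algebra_continuous: "flat_algebra f \<Longrightarrow> continuous_on UNIV f"
  by (metis DERIV_continuous_on flat_algebra_deriv has_field_derivative_at_within)

text \<open>The first factor vanishes for x \<le> -r, the second for x \<ge> r.\<close>

definition bump :: "real \<Rightarrow> real \<Rightarrow> real" where
  "bump r x = flat 0 (x + r) * flat 0 (r - x)"

lemma bump_nonneg: "0 \<le> bump r x"
  by (simp add: bump_def flat_nonneg)

lemma bump_pos: "\<bar>x\<bar> < r \<Longrightarrow> 0 < bump r x"
  by (simp add: bump_def flat_pos_iff)

lemma bump_eq_0: "r \<le> \<bar>x\<bar> \<Longrightarrow> bump r x = 0"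
  by (auto simp: bump_def flat_def abs_if split: if_splits)

lemma flat_algebra_bump: "flat_algebra (\<lambda>x. bump r (x - c))"
proof -
  have "flat_algebra (\<lambda>x. flat 0 (1 * x + (r - c)) * flat 0 ((- 1) * x + (r + c)))"
    by (intro flat_algebra.intros)
  then show ?thesis
    by (simp add: bump_def algebra_simps)
qed

lemma test_functionI:
  assumes "\<And>n x. (deriv ^^ n) \<phi> field_differentiable (at x)" and "\<And>x. R < \<bar>x\<bar> \<Longrightarrow> \<phi> x = 0"
  shows "\<phi> \<in> test_functions"
proof -
  have "{x. \<phi> x \<noteq> 0} \<subseteq> cball 0 R"
    using assms(2) by (force simp: dist_real_def)
  then have "fun_support \<phi> \<subseteq> cball 0 R"
    unfolding fun_support_def by (rule closure_minimal) simp
  then have "compact (fun_support \<phi>)"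
    unfolding fun_support_def by (metis bounded_cball bounded_subset closed_closure compact_eq_bounded_closed)
  with assms(1) show ?thesis
    by (simp add: test_functions_def)
qed

text \<open>\<open>P\<close> is constant on each side of the support, but for r > 0 the two
  constants differ, so \<open>P\<close> itself has no compact support. This is why the next lemma
  takes a difference of translates.\<close>

lemma bump_antiderivative:
  obtains P where "\<And>x. (P has_real_derivative bump r x) (at x)"
    and "\<And>x. r \<le> x \<Longrightarrow> P x = P r" and "\<And>x. x \<le> - r \<Longrightarrow> P x = P (- r)"
proof -
  have "continuous_on UNIV (bump r)"
    using flat_algebra_continuous[OF flat_algebra_bump[of r 0]] by simp
  then have "\<exists>P. \<forall>x. - \<infinity> < ereal x \<longrightarrow> ereal x < \<infinity> \<longrightarrow> (P has_vector_derivative bump r x) (at x)"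
    by (intro einterval_antiderivative) (auto simp: continuous_on_eq_continuous_at)
  then obtain P where P: "\<And>x. (P has_real_derivative bump r x) (at x)"
    by (auto simp: has_real_derivative_iff_has_vector_derivative)
  have 0: "(P has_real_derivative 0) (at x within S)" if "r \<le> \<bar>x\<bar>" for x S
    using P[of x] that by (auto simp: bump_eq_0 intro: has_field_derivative_at_within)
  have "\<exists>c. \<forall>x\<in>{r..}. P x = c"
    by (rule has_field_derivative_zero_constant) (auto intro: 0)
  moreover have "\<exists>c. \<forall>x\<in>{..- r}. P x = c"
    by (rule has_field_derivative_zero_constant) (auto intro!: 0)
  ultimately show ?thesis
    using that[OF P] by fastforce
qed

text \<open>Far out on either side, both translates of the antiderivative take the same constant
  value, so their difference vanishes there.\<close>

lemma bump_difference_test_function: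
  obtains \<phi> where "\<phi> \<in> test_functions" and "deriv \<phi> \<in> test_functions"
    and "deriv \<phi> = (\<lambda>x. bump r (x - c) - bump r (x - d))"
proof -
  obtain P where P: "\<And>x. (P has_real_derivative bump r x) (at x)"
    and r: "\<And>x. r \<le> x \<Longrightarrow> P x = P r" "\<And>x. x \<le> - r \<Longrightarrow> P x = P (- r)"
    using bump_antiderivative by blast
  define \<phi> where "\<phi> x = P (x - c) - P (x - d)" for x
  let ?\<phi>' = "\<lambda>x. bump r (x - c) - bump r (x - d)"
  define R where "R = \<bar>c\<bar> + \<bar>d\<bar> + \<bar>r\<bar>"
  have shift: "((\<lambda>x. P (x - a)) has_real_derivative bump r (x - a)) (at x)" for a x
    using DERIV_shift[of P "bump r (x - a)" x "- a"] P by simp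
  have D: "(\<phi> has_real_derivative ?\<phi>' x) (at x)" for x
    unfolding \<phi>_def[abs_def] by (intro DERIV_diff shift)
  then have \<phi>': "deriv \<phi> = ?\<phi>'"
    by (intro ext DERIV_imp_deriv)
  have "flat_algebra (\<lambda>x. bump r (x - c) + (- 1) * bump r (x - d))"
    by (intro flat_algebra.add flat_algebra.mult flat_algebra.const flat_algebra_bump)
  then have alg: "flat_algebra (deriv \<phi>)"
    by (simp add: \<phi>')
  \<comment> \<open>Only the derivative of \<open>\<phi>\<close> is known to lie in
    \<open>flat_algebra\<close>, so order 0 is treated separately and higher orders are shifted by
    one.\<close>
  have "(deriv ^^ n) \<phi> field_differentiable (at x)" for n x
  proof (cases n)
    case 0
    then show ?thesis using D by (auto simp: field_differentiable_def)
  next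
    case (Suc m)
    then show ?thesis
      using flat_algebra_smooth[OF alg] by (simp add: funpow_swap1)
  qed
  moreover have "\<phi> x = 0" if "R < \<bar>x\<bar>" for x
  proof (cases "0 \<le> x")
    case True
    then have "r \<le> x - c" "r \<le> x - d"
      using that by (auto simp: R_def)
    then show ?thesis
      using r(1)[of "x - c"] r(1)[of "x - d"] by (simp add: \<phi>_def)
  next
    case False
    then have "x - c \<le> - r" "x - d \<le> - r"
      using that by (auto simp: R_def)
    then show ?thesis
      using r(2)[of "x - c"] r(2)[of "x - d"] by (simp add: \<phi>_def)
  qed
  ultimately have 1: "\<phi> \<in> test_functions"
    by (rule test_functionI)
  have "deriv \<phi> x = 0" if "R < \<bar>x\<bar>" for x
    using that unfolding \<phi>' by (simp add: R_def bump_eq_0)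
  then have "deriv \<phi> \<in> test_functions"
    using flat_algebra_smooth[OF alg] by (intro test_functionI)
  with 1 \<phi>' that show ?thesis by blast
qed

section \<open>Uniqueness of primitives\<close>

lemma integrable_lborel_compact_support:
  fixes f :: "real \<Rightarrow> real"
  assumes "continuous_on UNIV f" and "\<And>x. R < \<bar>x\<bar> \<Longrightarrow> f x = 0"
  shows "integrable lborel f"
proof -
  have "integrable lborel (\<lambda>x. indicator {-R..R} x *\<^sub>R f x)"
    using assms(1) by (intro borel_integrable_compact) (auto intro: continuous_on_subset)
  also have "(\<lambda>x. indicator {-R..R} x *\<^sub>R f x) = f"
    using assms(2) by (force simp: indicator_def fun_eq_iff)
  finally show ?thesis .
qed

text \<open>The set where \<open>f\<close> is nonzero is open by continuity and null because the
  integral vanishes, hence empty.\<close>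

lemma continuous_nonneg_integral_0:
  fixes f :: "real \<Rightarrow> real"
  assumes "continuous_on UNIV f" and "\<And>x. 0 \<le> f x"
    and "integrable lborel f" and "(LINT x|lborel. f x) = 0"
  shows "f x = 0"
proof (rule ccontr)
  assume "f x \<noteq> 0"
  have "AE x in lborel. f x = 0"
    using assms integral_nonneg_eq_0_iff_AE[of lborel f] by simp
  then have "AE x in lebesgue. f x = 0"
    by (rule AE_completion)
  then have "negligible {x. f x \<noteq> 0}"
    by (simp add: negligible_iff_null_sets completion.AE_iff_null_sets)
  moreover have "open {x. f x \<noteq> 0}"
    by (intro open_Collect_neq assms) auto
  ultimately show False
    using open_not_negligible \<open>f x \<noteq> 0\<close> by blast
qed

text \<open>
  The test function has derivative \<open>\<rho>(x - c) - \<rho>(x - d)\<close> for a bump \<open>\<rho>\<close> and \<open>d\<close> close to \<open>-\<infinity>\<close>.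
  This derivative has integral zero, so a constant \<open>s\<close> between \<open>0\<close> and \<open>H c\<close> can be subtracted
  from \<open>H\<close>, which makes the integrand nonnegative.
\<close>

lemma nonpos_if_distribution_deriv_0:
  fixes H :: "real \<Rightarrow> real"
  assumes cont: "continuous_on UNIV H" and lim: "(H \<longlongrightarrow> 0) at_bot"
    and 0: "\<And>\<phi>. \<phi> \<in> test_functions \<Longrightarrow> deriv \<phi> \<in> test_functions \<Longrightarrow>
      (LINT x|lborel. H x * deriv \<phi> x) = 0"
  shows "H c \<le> 0"
proof (rule ccontr)
  assume "\<not> H c \<le> 0"
  define s where "s = H c / 2"
  have s: "0 < s" "s < H c"
    using \<open>\<not> H c \<le> 0\<close> by (auto simp: s_def)
  have "isCont H c"
    using cont by (simp add: continuous_on_eq_continuous_at)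
  then have "eventually (\<lambda>x. s < H x) (nhds c)"
    using s(2) by (simp add: order_tendstoD(1) isCont_def tendsto_at_iff_tendsto_nhds)
  then obtain r where r: "0 < r" "\<And>x. \<bar>x - c\<bar> < r \<Longrightarrow> s < H x"
    by (auto simp: eventually_nhds_metric dist_real_def)
  have "eventually (\<lambda>x. H x < s) at_bot"
    using lim s(1) by (rule order_tendstoD)
  then obtain T where T: "\<And>x. x \<le> T \<Longrightarrow> H x < s"
    by (auto simp: eventually_at_bot_linorder)
  \<comment> \<open>\<open>T - r\<close> places the second bump where H < s;
    \<open>c - 2 * r\<close> makes the two open supports disjoint.\<close>
  define d where "d = min (T - r) (c - 2 * r)"
  obtain \<phi> where \<phi>: "\<phi> \<in> test_functions" "deriv \<phi> \<in> test_functions"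
    and \<phi>': "deriv \<phi> = (\<lambda>x. bump r (x - c) - bump r (x - d))"
    using bump_difference_test_function by blast
  define R where "R = \<bar>c\<bar> + \<bar>d\<bar> + \<bar>r\<bar>"
  have bump_cont: "continuous_on UNIV (\<lambda>x. bump r (x - a))" for a
    by (intro flat_algebra_continuous flat_algebra_bump)
  have bump_int: "integrable lborel (\<lambda>x. bump r (x - a))" for a
    by (rule integrable_lborel_compact_support[OF bump_cont, of "\<bar>a\<bar> + \<bar>r\<bar>"])
      (auto intro!: bump_eq_0)
  have "(LINT x|lborel. bump r (x - a)) = (LINT x|lborel. bump r x)" for a
    using lborel_integral_real_affine[of 1 "\<lambda>x. bump r (x - a)" a] by simp
  then have mean_0: "(LINT x|lborel. deriv \<phi> x) = 0"
    by (simp add: \<phi>' bump_int)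
  have \<phi>'_cont: "continuous_on UNIV (deriv \<phi>)"
    unfolding \<phi>' by (intro continuous_intros bump_cont)
  have \<phi>'_0: "deriv \<phi> x = 0" if "R < \<bar>x\<bar>" for x
    using that unfolding \<phi>' by (simp add: R_def bump_eq_0)
  let ?f = "\<lambda>x. (H x - s) * deriv \<phi> x"
  have f_cont: "continuous_on UNIV ?f"
    by (intro continuous_intros cont \<phi>'_cont)
  have int: "integrable lborel (\<lambda>x. H x * deriv \<phi> x)" "integrable lborel (deriv \<phi>)" "integrable lborel ?f"
    by (rule integrable_lborel_compact_support[where R = R];
        auto intro!: continuous_intros cont \<phi>'_cont simp: \<phi>'_0)+
  have "(LINT x|lborel. ?f x) = (LINT x|lborel. H x * deriv \<phi> x - s * deriv \<phi> x)"
    by (simp add: algebra_simps)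
  also have "\<dots> = 0"
    using int 0[OF \<phi>] mean_0 by simp
  finally have "(LINT x|lborel. ?f x) = 0" .
  moreover have "0 \<le> ?f x" for x
  proof -
    consider "\<bar>x - c\<bar> < r" | "\<bar>x - d\<bar> < r" | "r \<le> \<bar>x - c\<bar>" "r \<le> \<bar>x - d\<bar>"
      by linarith
    then show ?thesis
    proof cases
      case 1
      then have "deriv \<phi> x = bump r (x - c)"
        unfolding \<phi>' d_def by (auto intro!: bump_eq_0)
      then show ?thesis
        using r(2)[OF 1] by (simp add: bump_nonneg)
    next
      case 2
      then have "deriv \<phi> x = - bump r (x - d)"
        unfolding \<phi>' d_def by (auto intro!: bump_eq_0)
      moreover have "H x < s"
        using 2 by (intro T) (auto simp: d_def)
      ultimately show ?thesis
        by (simp add: bump_nonneg mult_nonpos_nonneg)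
    next
      case 3
      then show ?thesis
        by (simp add: \<phi>' bump_eq_0)
    qed
  qed
  \<comment> \<open>The contradiction comes at \<open>c\<close>, where both factors of the integrand
    are positive.\<close>
  ultimately have "?f c = 0"
    using f_cont int(3) continuous_nonneg_integral_0[of ?f c] by simp
  moreover have "deriv \<phi> c = bump r 0"
    using r(1) unfolding \<phi>' by (simp add: d_def bump_eq_0)
  moreover have "0 < bump r 0"
    using r(1) by (simp add: bump_pos)
  ultimately show False
    using s(2) by simp
qed

text \<open>The preceding lemma, applied to the difference of two primitives in both orders, gives
  equality on the reals. The values at the infinite points follow from the limit at infinity and the
  normalization at minus infinity.\<close>

lemma is_primitive_unique:
  assumes F: "is_primitive F f" and G: "is_primitive G f"
  shows "F = G"
proof -
  note defs = is_primitive_def B_C_def C0_ext_def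
  have *: "F' (ereal c) \<le> G' (ereal c)" if F': "is_primitive F' f" and G': "is_primitive G' f" for F' G' c
  proof -
    have cont: "continuous_on UNIV (\<lambda>x. F' (ereal x))" "continuous_on UNIV (\<lambda>x. G' (ereal x))"
      using F' G' by (auto simp: defs)
    have "((\<lambda>x. F' (ereal x) - G' (ereal x)) \<longlongrightarrow> 0 - 0) at_bot"
      using F' G' by (intro tendsto_diff) (auto simp: defs)
    \<comment> \<open>Both memberships matter: \<open>distribution_deriv\<close> unfolds only at a
      test function \<open>\<phi>\<close>, and the inner functional is an integral only if
      \<open>deriv \<phi>\<close> is one too.\<close>
    moreover have "(LINT x|lborel. (F' (ereal x) - G' (ereal x)) * deriv \<phi> x) = 0"
      if \<phi>: "\<phi> \<in> test_functions" "deriv \<phi> \<in> test_functions" for \<phi>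
    proof -
      have diff: "continuous_on UNIV (deriv \<phi>)"
      proof -
        have "(deriv ^^ Suc 0) \<phi> field_differentiable at x" for x
          using \<phi>(1) unfolding test_functions_def by blast
        then show ?thesis
          by (auto simp: continuous_on_eq_continuous_at intro: field_differentiable_imp_continuous_at)
      qed
      have "bounded (fun_support (deriv \<phi>))"
        using \<phi>(2) by (auto simp: test_functions_def compact_imp_bounded)
      then obtain R where R: "\<And>x. x \<in> fun_support (deriv \<phi>) \<Longrightarrow> \<bar>x\<bar> \<le> R"
        by (auto simp: bounded_iff)
      have out: "deriv \<phi> x = 0" if "R < \<bar>x\<bar>" for x
        using R[of x] that closure_subset[of "{x. deriv \<phi> x \<noteq> 0}"] by (force simp: fun_support_def)
      have int: "integrable lborel (\<lambda>x. K (ereal x) * deriv \<phi> x)"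
        if "continuous_on UNIV (\<lambda>x. K (ereal x))" for K :: "ereal \<Rightarrow> real"
        by (rule integrable_lborel_compact_support[where R = R])
          (auto intro!: continuous_intros that diff simp: out)
      have "distribution_deriv (distribution_of_fun (\<lambda>x. F' (ereal x))) \<phi>
          = distribution_deriv (distribution_of_fun (\<lambda>x. G' (ereal x))) \<phi>"
        using F' G' by (simp add: is_primitive_def)
      then have "(LINT x|lborel. F' (ereal x) * deriv \<phi> x) = (LINT x|lborel. G' (ereal x) * deriv \<phi> x)"
        using \<phi> by (simp add: distribution_deriv_def distribution_of_fun_def)
      then show ?thesis
        using int[OF cont(1)] int[OF cont(2)] by (simp add: left_diff_distrib)
    qed
    ultimately show ?thesis
      using nonpos_if_distribution_deriv_0[of "\<lambda>x. F' (ereal x) - G' (ereal x)" c] cont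
      by (force intro: continuous_intros)
  qed
  have real: "F (ereal c) = G (ereal c)" for c
    using *[OF F G] *[OF G F] by (rule antisym)
  have "((\<lambda>x. F (ereal x)) \<longlongrightarrow> F \<infinity>) at_top" "((\<lambda>x. F (ereal x)) \<longlongrightarrow> G \<infinity>) at_top"
    using F G by (auto simp: defs real)
  then have "F \<infinity> = G \<infinity>"
    by (intro tendsto_unique[OF trivial_limit_at_top_linorder])
  moreover have "F (-\<infinity>) = G (-\<infinity>)"
    using F G by (auto simp: defs)
  ultimately show ?thesis
    by (intro ext) (metis real ereal_cases)
qed

lemma primitive_in_B_C:
  assumes "f \<in> A_C"
  shows "primitive f \<in> B_C"
proof -
  obtain F where F: "is_primitive F f"
    using assms by (auto simp: A_C_def)
  then have "primitive f = F"
    unfolding primitive_def by (intro the_equality) (auto intro: is_primitive_unique)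
  with F show ?thesis
    by (simp add: is_primitive_def)
qed

section \<open>Riemann--Stieltjes integrals against monotone functions\<close>

text \<open>The punctured neighbourhood filters of the extended line are images under
  \<open>ereal\<close> of those at real points, of \<open>at_top\<close> and of
  \<open>at_bot\<close>. Compactness and connectedness of the extended line thereby become usable
  for \<open>F\<close>.\<close>

lemma C0_ext_continuous:
  assumes "F \<in> C0_ext"
  shows "continuous_on UNIV F"
proof -
  have F: "continuous_on UNIV (\<lambda>x::real. F (ereal x))" "((\<lambda>x::real. F (ereal x)) \<longlongrightarrow> F \<infinity>) at_top"
    "((\<lambda>x::real. F (ereal x)) \<longlongrightarrow> F (-\<infinity>)) at_bot"
    using assms by (auto simp: C0_ext_def)
  have "at (-\<infinity>) = at_right (-\<infinity>::ereal)"
    by (auto simp: at_within_def intro!: arg_cong[where f = "\<lambda>S. inf (nhds (-\<infinity>)) (principal S)"])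
  then have at_MInf: "at (-\<infinity>) = filtermap ereal at_bot"
    by (simp add: at_right_MInf)
  have "isCont F x" for x
  proof (cases x)
    case (real r)
    have "isCont (\<lambda>x. F (ereal x)) r"
      using F(1) by (simp add: continuous_on_eq_continuous_at)
    then show ?thesis
      unfolding real isCont_def by (simp add: at_ereal filterlim_filtermap)
  next
    case PInf
    then show ?thesis
      using F(2) unfolding PInf isCont_def by (simp add: at_infty_ereal_eq_at_top filterlim_filtermap)
  next
    case MInf
    then show ?thesis
      using F(3) unfolding MInf isCont_def by (simp add: at_MInf filterlim_filtermap)
  qed
  then show ?thesis
    by (simp add: continuous_on_eq_continuous_at)
qed

text \<open>Sublevel sets of a monotone function are intervals.\<close>

lemma borel_measurable_mono_ereal:
  fixes h :: "real \<Rightarrow> ereal"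
  assumes "mono h"
  shows "h \<in> borel_measurable borel"
proof (rule borel_measurableI_le)
  fix a
  have "is_interval {y. h y \<le> a}"
    unfolding is_interval_1 using assms by (auto intro: order_trans monoD)
  then show "{y \<in> space borel. h y \<le> a} \<in> sets borel"
    by (simp add: real_interval_borel_measurable)
qed

text \<open>
  \<open>G\<close> is an indefinite integral of \<open>F \<circ> h\<close>, with \<open>h y = Sup {x. g x \<le> y}\<close> the generalized inverse
  of \<open>g\<close>: if \<open>g u < y < g v\<close> then \<open>u \<le> h y \<le> v\<close>. Thus \<open>G (g v) - G (g u)\<close> plays the role
  of the integral of \<open>F\<close> against \<open>g\<close> over \<open>{u..v}\<close>.
\<close>

lemma mono_generalized_inverse:
  fixes F :: "ereal \<Rightarrow> real" and g :: "ereal \<Rightarrow> real"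
  assumes F: "continuous_on UNIV F" and g: "mono g"
  obtains G where "continuous_on {g (-\<infinity>)..g \<infinity>} G"
    and "\<And>u v m. u \<le> v \<Longrightarrow> (\<And>x. u \<le> x \<Longrightarrow> x \<le> v \<Longrightarrow> m \<le> F x) \<Longrightarrow> m * (g v - g u) \<le> G (g v) - G (g u)"
    and "\<And>u v M. u \<le> v \<Longrightarrow> (\<And>x. u \<le> x \<Longrightarrow> x \<le> v \<Longrightarrow> F x \<le> M) \<Longrightarrow> G (g v) - G (g u) \<le> M * (g v - g u)"
proof
  define h where "h y = Sup {x. g x \<le> y}" for y
  define \<kappa> where "\<kappa> y = F (h y)" for y
  define G where "G y = integral {g (-\<infinity>)..y} \<kappa>" for y
  have "mono h"
    by (auto simp: h_def mono_def intro!: Sup_subset_mono)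
  then have "\<kappa> \<in> borel_measurable borel"
    unfolding \<kappa>_def[abs_def]
    using F borel_measurable_continuous_onI borel_measurable_mono_ereal measurable_compose by blast
  then have meas: "\<kappa> \<in> borel_measurable (lebesgue_on S)" for S
    by (intro measurable_restrict_space1 measurable_completion) simp
  \<comment> \<open>\<open>h\<close> may jump, so \<open>\<kappa>\<close> need not be continuous;
    being measurable and bounded makes it integrable.\<close>
  have "bounded (range F)"
    using compact_continuous_image[OF F compact_UNIV] by (rule compact_imp_bounded)
  then obtain B where B: "\<And>x. \<bar>F x\<bar> \<le> B"
    by (auto simp: bounded_iff)
  have int: "\<kappa> integrable_on {a..b}" for a b
    by (rule measurable_bounded_by_integrable_imp_integrable_real[OF meas, of "\<lambda>_. B"])
      (auto simp: \<kappa>_def B)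
  show "continuous_on {g (-\<infinity>)..g \<infinity>} G"
    unfolding G_def[abs_def] by (intro indefinite_integral_continuous_1 int)
  have le: "g u \<le> g v" if "u \<le> v" for u v
    using g that by (rule monoD)
  \<comment> \<open>Open intervals are used because \<open>h y\<close> is located in
    \<open>{u..v}\<close> only for y strictly between \<open>g u\<close> and \<open>g v\<close>: if
    \<open>g\<close> is constant just to the right of \<open>v\<close>, then \<open>h (g v)\<close>
    exceeds \<open>v\<close>.\<close>
  have diff: "G (g v) - G (g u) = integral {g u<..<g v} \<kappa>" if "u \<le> v" for u v
  proof -
    have "integral {g (-\<infinity>)..g u} \<kappa> + integral {g u..g v} \<kappa> = integral {g (-\<infinity>)..g v} \<kappa>"
      using that by (intro Henstock_Kurzweil_Integration.integral_combine int le) auto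
    then show ?thesis
      by (simp add: G_def integral_open_interval_real)
  qed
  have const: "integral {g u<..<g v} (\<lambda>_. c) = c * (g v - g u)" if "u \<le> v" for u v c
    using le[OF that] by (simp flip: integral_open_interval_real)
  have h: "u \<le> h y" "h y \<le> v" if "g u < y" "y < g v" for u v y
  proof -
    show "u \<le> h y"
      using that unfolding h_def by (intro Sup_upper) auto
    show "h y \<le> v"
      unfolding h_def
    proof (rule Sup_least)
      fix x assume "x \<in> {x. g x \<le> y}"
      then show "x \<le> v"
        by (metis le leD le_less_trans linear mem_Collect_eq that(2))
    qed
  qed
  show "m * (g v - g u) \<le> G (g v) - G (g u)"
    if "u \<le> v" "\<And>x. u \<le> x \<Longrightarrow> x \<le> v \<Longrightarrow> m \<le> F x" for u v m
    unfolding diff[OF that(1)] const[OF that(1), symmetric]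
    using h that(2) by (intro integral_le) (auto simp: integrable_on_open_interval_real int \<kappa>_def)
  show "G (g v) - G (g u) \<le> M * (g v - g u)"
    if "u \<le> v" "\<And>x. u \<le> x \<Longrightarrow> x \<le> v \<Longrightarrow> F x \<le> M" for u v M
    unfolding diff[OF that(1)] const[OF that(1), symmetric]
    using h that(2) by (intro integral_le) (auto simp: integrable_on_open_interval_real int \<kappa>_def)
qed

text \<open>On a small cell \<open>{u..v}\<close> with tag \<open>x\<close>, \<open>F\<close> stays
  within e of \<open>F x\<close>. Taking \<open>F x - e\<close> and \<open>F x + e\<close> as bounds
  puts \<open>G v - G u\<close> within \<open>e * (g v - g u)\<close> of the term of the Riemann
  sum, and both differences telescope over the division.\<close>

lemma has_RS_integral_of_bounds:
  fixes F g G :: "real \<Rightarrow> real"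
  assumes "a \<le> b" and F: "continuous_on {a..b} F"
    and lower: "\<And>u v m. a \<le> u \<Longrightarrow> u \<le> v \<Longrightarrow> v \<le> b \<Longrightarrow> (\<And>x. u \<le> x \<Longrightarrow> x \<le> v \<Longrightarrow> m \<le> F x) \<Longrightarrow>
      m * (g v - g u) \<le> G v - G u"
    and upper: "\<And>u v M. a \<le> u \<Longrightarrow> u \<le> v \<Longrightarrow> v \<le> b \<Longrightarrow> (\<And>x. u \<le> x \<Longrightarrow> x \<le> v \<Longrightarrow> F x \<le> M) \<Longrightarrow>
      G v - G u \<le> M * (g v - g u)"
  shows "has_RS_integral F g a b (G b - G a)"
  unfolding has_RS_integral_def
proof (intro allI impI)
  fix \<epsilon> :: real assume "0 < \<epsilon>"
  \<comment> \<open>The summand 1 avoids division by zero when \<open>g a = g b\<close> and makes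
    the final estimate strict.\<close>
  define e where "e = \<epsilon> / (\<bar>g b - g a\<bar> + 1)"
  have "0 < e"
    using \<open>0 < \<epsilon>\<close> by (simp add: e_def)
  have "uniformly_continuous_on {a..b} F"
    using F by (intro compact_uniformly_continuous) auto
  then obtain \<delta> where "0 < \<delta>"
    and \<delta>: "\<And>x y. x \<in> {a..b} \<Longrightarrow> y \<in> {a..b} \<Longrightarrow> dist y x < \<delta> \<Longrightarrow> dist (F y) (F x) < e"
    using \<open>0 < e\<close> unfolding uniformly_continuous_on_def by metis
  show "\<exists>\<delta>>0. \<forall>p. p tagged_division_of {a..b} \<and> (\<lambda>x. ball x \<delta>) fine p \<longrightarrow>
      \<bar>(\<Sum>(x, k)\<in>p. F x * (g (Sup k) - g (Inf k))) - (G b - G a)\<bar> < \<epsilon>"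
  proof (intro exI conjI allI impI; (elim conjE)?)
    show "0 < \<delta>" by fact
    fix p assume p: "p tagged_division_of {a..b}" and fine: "(\<lambda>x. ball x \<delta>) fine p"
    have cell: "\<bar>F x * (g (Sup k) - g (Inf k)) - (G (Sup k) - G (Inf k))\<bar> \<le> e * (g (Sup k) - g (Inf k))"
      if xk: "(x, k) \<in> p" for x k
    proof -
      obtain u v where k: "k = {u..v}"
        using tagged_division_ofD(4)[OF p xk] by auto
      have sub: "x \<in> {u..v}" "{u..v} \<subseteq> {a..b}"
        using tagged_division_ofD(2,3)[OF p xk] k by auto
      have "{u..v} \<subseteq> ball x \<delta>"
        using fine xk k by (auto simp: fine_def)
      then have "dist (F y) (F x) < e" if "y \<in> {u..v}" for y
        using that sub by (intro \<delta>) (auto simp: dist_commute)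
      then have osc: "F x - e \<le> F y" "F y \<le> F x + e" if "u \<le> y" "y \<le> v" for y
        using that by (force simp: dist_real_def abs_less_iff)+
      have uv: "a \<le> u" "u \<le> v" "v \<le> b"
        using sub by auto
      show ?thesis
        using lower[OF uv, of "F x - e"] upper[OF uv, of "F x + e"] osc uv k
        by (simp add: abs_le_iff algebra_simps)
    qed
    have "\<bar>(\<Sum>(x, k)\<in>p. F x * (g (Sup k) - g (Inf k))) - (G b - G a)\<bar>
        = \<bar>\<Sum>(x, k)\<in>p. F x * (g (Sup k) - g (Inf k)) - (G (Sup k) - G (Inf k))\<bar>"
      using additive_tagged_division_1[OF \<open>a \<le> b\<close> p, of G]
      by (simp add: case_prod_unfold sum_subtractf)
    also have "\<dots> \<le> (\<Sum>(x, k)\<in>p. e * (g (Sup k) - g (Inf k)))"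
      unfolding case_prod_unfold by (rule order_trans[OF sum_abs]) (auto intro!: sum_mono cell)
    also have "\<dots> = e * (g b - g a)"
      using additive_tagged_division_1[OF \<open>a \<le> b\<close> p, of g]
      by (simp add: case_prod_unfold flip: sum_distrib_left)
    also have "\<dots> < e * (\<bar>g b - g a\<bar> + 1)"
      using \<open>0 < e\<close> by simp
    also have "\<dots> = \<epsilon>"
      by (simp add: e_def add_nonneg_eq_0_iff)
    finally show "\<bar>(\<Sum>(x, k)\<in>p. F x * (g (Sup k) - g (Inf k))) - (G b - G a)\<bar> < \<epsilon>" .
  qed
qed

text \<open>Some tagged division is fine for both radii at once, and its sum would be closer than
  half of |I - J| to both values.\<close>

lemma has_RS_integral_unique:
  assumes I: "has_RS_integral F g a b I" and J: "has_RS_integral F g a b J"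
  shows "I = J"
proof (rule ccontr)
  assume "I \<noteq> J"
  define \<epsilon> where "\<epsilon> = \<bar>I - J\<bar> / 2"
  have "0 < \<epsilon>"
    using \<open>I \<noteq> J\<close> by (simp add: \<epsilon>_def)
  let ?S = "\<lambda>p. \<Sum>(x, k)\<in>p. F x * (g (Sup k) - g (Inf k))"
  obtain d where d: "0 < d"
    "\<And>p. p tagged_division_of {a..b} \<Longrightarrow> (\<lambda>x. ball x d) fine p \<Longrightarrow> \<bar>?S p - I\<bar> < \<epsilon>"
    using I[unfolded has_RS_integral_def, rule_format, OF \<open>0 < \<epsilon>\<close>] by auto
  obtain d' where d': "0 < d'"
    "\<And>p. p tagged_division_of {a..b} \<Longrightarrow> (\<lambda>x. ball x d') fine p \<Longrightarrow> \<bar>?S p - J\<bar> < \<epsilon>"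
    using J[unfolded has_RS_integral_def, rule_format, OF \<open>0 < \<epsilon>\<close>] by auto
  have "gauge (\<lambda>x. ball x d \<inter> ball x d')"
    using d(1) d'(1) by (intro gauge_Int gauge_ball)
  then obtain p where p: "p tagged_division_of {a..b}" "(\<lambda>x. ball x d \<inter> ball x d') fine p"
    by (rule fine_division_exists_real)
  then have "(\<lambda>x. ball x d) fine p" "(\<lambda>x. ball x d') fine p"
    by (auto simp: fine_Int)
  then have "\<bar>?S p - I\<bar> < \<epsilon>" "\<bar>?S p - J\<bar> < \<epsilon>"
    using p(1) d(2) d'(2) by blast+
  then show False
    using abs_triangle_ineq4[of "?S p - J" "?S p - I"] by (simp add: \<epsilon>_def)
qed

lemma RS_integral_eq: "has_RS_integral F g a b I \<Longrightarrow> RS_integral F g a b = I"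
  unfolding RS_integral_def by (rule the_equality) (auto intro: has_RS_integral_unique)

lemma has_RS_integral_uminus:
  assumes "has_RS_integral F g a b I"
  shows "has_RS_integral F (\<lambda>x. - g x) a b (- I)"
proof -
  have "\<bar>(\<Sum>(x, k)\<in>p. F x * (- g (Sup k) - - g (Inf k))) - - I\<bar>
      = \<bar>(\<Sum>(x, k)\<in>p. F x * (g (Sup k) - g (Inf k))) - I\<bar>" for p
  proof -
    have "(\<Sum>(x, k)\<in>p. F x * (- g (Sup k) - - g (Inf k)))
        = - (\<Sum>(x, k)\<in>p. F x * (g (Sup k) - g (Inf k)))"
      by (simp add: case_prod_unfold algebra_simps flip: sum_negf)
    then show ?thesis by simp
  qed
  then show ?thesis
    using assms by (simp add: has_RS_integral_def)
qed

section \<open>Integrals over the extended line, with jumps at infinity\<close>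

lemma RS_integral_ext_eq:
  fixes F g :: "ereal \<Rightarrow> real"
  assumes R: "\<And>A B. A \<le> B \<Longrightarrow> has_RS_integral (\<lambda>x. F (ereal x)) (\<lambda>x. g (ereal x)) A B (R A B)"
    and J: "((\<lambda>(A, B). R A B) \<longlongrightarrow> J) (at_bot \<times>\<^sub>F at_top)"
    and Lp: "((\<lambda>x::real. g (ereal x)) \<longlongrightarrow> Lp) at_top" and Lm: "((\<lambda>x::real. g (ereal x)) \<longlongrightarrow> Lm) at_bot"
  shows "RS_integral_ext F g = J + F \<infinity> * (g \<infinity> - Lp) + F (-\<infinity>) * (Lm - g (-\<infinity>))"
proof -
  \<comment> \<open>Knowing the integrals for A \<le> B suffices, since the filter eventually forces
    A \<le> 0 \<le> B.\<close>
  have "eventually (\<lambda>(A, B). A \<le> B) (at_bot \<times>\<^sub>F at_top :: (real \<times> real) filter)"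
    unfolding eventually_prod_filter
    by (rule exI[of _ "\<lambda>A. A \<le> 0"], rule exI[of _ "\<lambda>B. 0 \<le> B"]) auto
  then have "eventually (\<lambda>(A, B). R A B = RS_integral (\<lambda>x. F (ereal x)) (\<lambda>x. g (ereal x)) A B)
      (at_bot \<times>\<^sub>F at_top)"
    by (rule eventually_mono) (auto simp: RS_integral_eq[OF R])
  then have "((\<lambda>(A, B). RS_integral (\<lambda>x. F (ereal x)) (\<lambda>x. g (ereal x)) A B) \<longlongrightarrow> J) (at_bot \<times>\<^sub>F at_top)"
    by (intro Lim_transform_eventually[OF J]) (simp add: case_prod_unfold)
  then have "Lim (at_bot \<times>\<^sub>F at_top) (\<lambda>(A, B). RS_integral (\<lambda>x. F (ereal x)) (\<lambda>x. g (ereal x)) A B) = J"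
    by (intro tendsto_Lim) (auto simp: prod_filter_eq_bot)
  then show ?thesis
    using tendsto_Lim[OF _ Lp] tendsto_Lim[OF _ Lm] by (simp add: RS_integral_ext_def)
qed

text \<open>The limits are the supremum and infimum over the reals, bounded by the values at the
  infinite points. The inequalities say that all three parts of the total increase of
  \<open>g\<close> are nonnegative.\<close>

lemma mono_tendsto_ereal:
  fixes g :: "ereal \<Rightarrow> real"
  assumes "mono g"
  obtains Lp Lm where "((\<lambda>x::real. g (ereal x)) \<longlongrightarrow> Lp) at_top" and "((\<lambda>x::real. g (ereal x)) \<longlongrightarrow> Lm) at_bot"
    and "g (-\<infinity>) \<le> Lm" and "Lp \<le> g \<infinity>" and "Lm \<le> Lp"
proof
  let ?g = "\<lambda>x::real. g (ereal x)"
  have le: "g u \<le> g v" if "u \<le> v" for u v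
    using assms that by (rule monoD)
  have bdd: "bdd_above (range ?g)" "bdd_below (range ?g)"
    by (auto intro!: bdd_aboveI[of _ "g \<infinity>"] bdd_belowI[of _ "g (-\<infinity>)"] le)
  show "(?g \<longlongrightarrow> (SUP x. ?g x)) at_top"
  proof (rule increasing_tendsto)
    fix y assume "y < (SUP x. ?g x)"
    then obtain x where "y < ?g x"
      using bdd by (auto simp: less_cSUP_iff)
    then have "\<And>z. x \<le> z \<Longrightarrow> y < ?g z"
      by (meson le less_le_trans ereal_less_eq(3))
    then show "eventually (\<lambda>x. y < ?g x) at_top"
      unfolding eventually_at_top_linorder by blast
  qed (intro always_eventually allI cSUP_upper bdd UNIV_I)
  show "(?g \<longlongrightarrow> (INF x. ?g x)) at_bot"
  proof (rule decreasing_tendsto)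
    fix y assume "(INF x. ?g x) < y"
    then obtain x where "?g x < y"
      using bdd by (auto simp: cINF_less_iff)
    then have "\<And>z. z \<le> x \<Longrightarrow> ?g z < y"
      by (meson le le_less_trans ereal_less_eq(3))
    then show "eventually (\<lambda>x. ?g x < y) at_bot"
      unfolding eventually_at_bot_linorder by blast
  qed (intro always_eventually allI cINF_lower bdd UNIV_I)
  show "g (-\<infinity>) \<le> (INF x. ?g x)"
    by (auto intro!: cINF_greatest le)
  show "(SUP x. ?g x) \<le> g \<infinity>"
    by (auto intro!: cSUP_least le)
  show "(INF x. ?g x) \<le> (SUP x. ?g x)"
    using bdd by (meson UNIV_I cINF_lower cSUP_upper order_trans)
qed

text \<open>The integrator \<open>- g\<close> is included here because
  \<open>RS_integral_ext\<close> rests on \<open>Lim\<close> and \<open>THE\<close>: passing from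
  \<open>g\<close> to \<open>- g\<close> uses the existence and convergence facts established inside
  this proof.\<close>

lemma RS_integral_ext_mean_value:
  fixes F g :: "ereal \<Rightarrow> real"
  assumes F: "F \<in> C0_ext" and g: "mono g"
  obtains \<xi> where "RS_integral_ext F g = F \<xi> * (g \<infinity> - g (-\<infinity>))"
    and "RS_integral_ext F (\<lambda>x. - g x) = - (F \<xi> * (g \<infinity> - g (-\<infinity>)))"
proof -
  have contF: "continuous_on UNIV F"
    using F by (rule C0_ext_continuous)
  obtain G where contG: "continuous_on {g (-\<infinity>)..g \<infinity>} G"
    and lower: "\<And>u v m. u \<le> v \<Longrightarrow> (\<And>x. u \<le> x \<Longrightarrow> x \<le> v \<Longrightarrow> m \<le> F x) \<Longrightarrow> m * (g v - g u) \<le> G (g v) - G (g u)"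
    and upper: "\<And>u v M. u \<le> v \<Longrightarrow> (\<And>x. u \<le> x \<Longrightarrow> x \<le> v \<Longrightarrow> F x \<le> M) \<Longrightarrow> G (g v) - G (g u) \<le> M * (g v - g u)"
    using mono_generalized_inverse[OF contF g] by blast
  obtain Lp Lm where Lp: "((\<lambda>x::real. g (ereal x)) \<longlongrightarrow> Lp) at_top"
    and Lm: "((\<lambda>x::real. g (ereal x)) \<longlongrightarrow> Lm) at_bot"
    and L: "g (-\<infinity>) \<le> Lm" "Lp \<le> g \<infinity>" "Lm \<le> Lp"
    using mono_tendsto_ereal[OF g] by blast
  define R where "R A B = G (g (ereal B)) - G (g (ereal A))" for A B :: real
  define J where "J = G Lp - G Lm"
  have R: "has_RS_integral (\<lambda>x. F (ereal x)) (\<lambda>x. g (ereal x)) A B (R A B)" if "A \<le> B" for A B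
    unfolding R_def
  proof (rule has_RS_integral_of_bounds[OF that])
    show "continuous_on {A..B} (\<lambda>x. F (ereal x))"
      using contF by (rule continuous_on_compose2) (auto intro: continuous_intros)
    fix u v c :: real assume "u \<le> v"
    then have uv: "ereal u \<le> ereal v" by simp
    \<comment> \<open>Extended reals between two finite ones are finite, so bounds on real points
      carry over.\<close>
    have *: "\<exists>y. x = ereal y \<and> u \<le> y \<and> y \<le> v" if "ereal u \<le> x" "x \<le> ereal v" for x
      using that by (cases x) auto
    show "c * (g (ereal v) - g (ereal u)) \<le> G (g (ereal v)) - G (g (ereal u))"
      if "\<And>x. u \<le> x \<Longrightarrow> x \<le> v \<Longrightarrow> c \<le> F (ereal x)"
      using uv by (rule lower) (use * that in blast)
    show "G (g (ereal v)) - G (g (ereal u)) \<le> c * (g (ereal v) - g (ereal u))"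
      if "\<And>x. u \<le> x \<Longrightarrow> x \<le> v \<Longrightarrow> F (ereal x) \<le> c"
      using uv by (rule upper) (use * that in blast)
  qed
  have range: "g x \<in> {g (-\<infinity>)..g \<infinity>}" for x
    using g by (auto intro: monoD)
  have fst: "((\<lambda>z. h (fst z)) \<longlongrightarrow> l) (at_bot \<times>\<^sub>F at_top)" if "(h \<longlongrightarrow> l) at_bot" for h :: "real \<Rightarrow> real" and l
    using that filterlim_fst by (rule filterlim_compose)
  have snd: "((\<lambda>z. h (snd z)) \<longlongrightarrow> l) (at_bot \<times>\<^sub>F at_top)" if "(h \<longlongrightarrow> l) at_top" for h :: "real \<Rightarrow> real" and l
    using that filterlim_snd by (rule filterlim_compose)
  \<comment> \<open>Continuity of \<open>G\<close> is what gives these limits, even if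
    \<open>g\<close> jumps at infinity; \<open>Lp\<close> and \<open>Lm\<close> lie in its domain of
    continuity.\<close>
  have "((\<lambda>x::real. G (g (ereal x))) \<longlongrightarrow> G Lp) at_top" "((\<lambda>x::real. G (g (ereal x))) \<longlongrightarrow> G Lm) at_bot"
    using L range
    by (auto intro!: continuous_on_tendsto_compose[OF contG Lp] continuous_on_tendsto_compose[OF contG Lm])
  then have J: "((\<lambda>(A, B). R A B) \<longlongrightarrow> J) (at_bot \<times>\<^sub>F at_top)"
    unfolding R_def J_def case_prod_unfold by (intro tendsto_diff fst snd)
  have jump: "((\<lambda>z. c * (g (ereal (snd z)) - g (ereal (fst z)))) \<longlongrightarrow> c * (Lp - Lm)) (at_bot \<times>\<^sub>F at_top)" for c
    by (intro tendsto_intros fst snd Lp Lm)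
  have ordered: "eventually (\<lambda>z. fst z \<le> snd z) (at_bot \<times>\<^sub>F at_top :: (real \<times> real) filter)"
    unfolding eventually_prod_filter
    by (rule exI[of _ "\<lambda>A. A \<le> 0"], rule exI[of _ "\<lambda>B. 0 \<le> B"]) auto
  have nontrivial: "at_bot \<times>\<^sub>F at_top \<noteq> (bot :: (real \<times> real) filter)"
    by (simp add: prod_filter_eq_bot)
  define I where "I = J + F \<infinity> * (g \<infinity> - Lp) + F (-\<infinity>) * (Lm - g (-\<infinity>))"
  obtain a b where a: "\<And>x. F a \<le> F x" and b: "\<And>x. F x \<le> F b"
    using continuous_attains_inf[OF compact_UNIV _ contF] continuous_attains_sup[OF compact_UNIV _ contF]
    by auto
  have "F a * (Lp - Lm) \<le> J"
    using nontrivial J jump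
  proof (rule tendsto_le)
    show "eventually (\<lambda>z. F a * (g (ereal (snd z)) - g (ereal (fst z))) \<le> (case z of (A, B) \<Rightarrow> R A B))
        (at_bot \<times>\<^sub>F at_top)"
      using ordered by (rule eventually_mono) (auto simp: R_def intro!: lower a)
  qed
  moreover have "J \<le> F b * (Lp - Lm)"
    using nontrivial jump J
  proof (rule tendsto_le)
    show "eventually (\<lambda>z. (case z of (A, B) \<Rightarrow> R A B) \<le> F b * (g (ereal (snd z)) - g (ereal (fst z))))
        (at_bot \<times>\<^sub>F at_top)"
      using ordered by (rule eventually_mono) (auto simp: R_def intro!: upper b)
  qed
  \<comment> \<open>The weights \<open>Lp - Lm\<close>, \<open>g \<infinity> - Lp\<close> and
    \<open>Lm - g (-\<infinity>)\<close> are nonnegative and add up to the total increase of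
    \<open>g\<close>.\<close>
  moreover have "F a * (g \<infinity> - Lp) \<le> F \<infinity> * (g \<infinity> - Lp)" "F \<infinity> * (g \<infinity> - Lp) \<le> F b * (g \<infinity> - Lp)"
    "F a * (Lm - g (-\<infinity>)) \<le> F (-\<infinity>) * (Lm - g (-\<infinity>))" "F (-\<infinity>) * (Lm - g (-\<infinity>)) \<le> F b * (Lm - g (-\<infinity>))"
    using L by (auto intro!: mult_right_mono a b)
  ultimately have I: "F a * (g \<infinity> - g (-\<infinity>)) \<le> I" "I \<le> F b * (g \<infinity> - g (-\<infinity>))"
    unfolding I_def by (simp_all add: algebra_simps)
  obtain \<xi> where \<xi>: "I = F \<xi> * (g \<infinity> - g (-\<infinity>))"
  \<comment> \<open>If the total increase is zero, both bounds force \<open>I = 0\<close> and any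
    point serves; otherwise \<open>I\<close> is divided by it to obtain a value of
    \<open>F\<close>.\<close>
  proof (cases "g \<infinity> = g (-\<infinity>)")
    case True
    then show ?thesis using I that[of 0] by simp
  next
    case False
    then have pos: "0 < g \<infinity> - g (-\<infinity>)"
      using L by simp
    have "{F a..F b} \<subseteq> range F"
      using contF by (intro connected_contains_Icc connected_continuous_image) auto
    moreover have "I / (g \<infinity> - g (-\<infinity>)) \<in> {F a..F b}"
      using I pos by (simp add: pos_divide_le_eq pos_le_divide_eq)
    ultimately obtain \<xi> where "I / (g \<infinity> - g (-\<infinity>)) = F \<xi>"
      by blast
    then show ?thesis
      using that[of \<xi>] pos by (simp add: field_simps)
  qed
  show ?thesis
  proof
    show "RS_integral_ext F g = F \<xi> * (g \<infinity> - g (-\<infinity>))"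
      using RS_integral_ext_eq[OF R J Lp Lm] by (simp add: I_def \<xi>[symmetric])
    have R': "has_RS_integral (\<lambda>x. F (ereal x)) (\<lambda>x. - g (ereal x)) A B (- R A B)" if "A \<le> B" for A B
      using R[OF that] by (rule has_RS_integral_uminus)
    have "((\<lambda>(A, B). - R A B) \<longlongrightarrow> - J) (at_bot \<times>\<^sub>F at_top)"
      using tendsto_minus[OF J] by (simp add: case_prod_unfold)
    then have "RS_integral_ext F (\<lambda>x. - g x)
        = - J + F \<infinity> * (- g \<infinity> - - Lp) + F (-\<infinity>) * (- Lm - - g (-\<infinity>))"
      by (intro RS_integral_ext_eq[OF R'] tendsto_minus Lp Lm)
    also have "\<dots> = - I"
      by (simp add: I_def algebra_simps)
    finally show "RS_integral_ext F (\<lambda>x. - g x) = - (F \<xi> * (g \<infinity> - g (-\<infinity>)))"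
      by (simp add: \<xi>)
  qed
qed

theorem theorem26:
  fixes f :: "(real \<Rightarrow> real) \<Rightarrow> real" and g :: "ereal \<Rightarrow> real"
  assumes "f \<in> A_C" and "mono g \<or> antimono g"
  shows "\<exists>\<xi>::ereal. AC_integral_mult f g =
           g (-\<infinity>) * AC_integral f (-\<infinity>) \<xi> + g \<infinity> * AC_integral f \<xi> \<infinity>"
proof -
  let ?F = "primitive f"
  have F: "?F \<in> C0_ext" "?F (-\<infinity>) = 0"
    using primitive_in_B_C[OF assms(1)] by (auto simp: B_C_def)
  have "\<exists>\<xi>. RS_integral_ext ?F g = ?F \<xi> * (g \<infinity> - g (-\<infinity>))"
    using assms(2)
  proof
    assume "mono g"
    then show ?thesis
      using RS_integral_ext_mean_value[OF F(1)] by metis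
  next
    assume "antimono g"
    then have "mono (\<lambda>x. - g x)"
      by (simp add: monotone_def)
    \<comment> \<open>The second conclusion of the lemma, for the increasing function
      \<open>- g\<close>, returns to \<open>g\<close>.\<close>
    then obtain \<xi> where "RS_integral_ext ?F (\<lambda>x. - (- g x)) = - (?F \<xi> * (- g \<infinity> - (- g (-\<infinity>))))"
      by (rule RS_integral_ext_mean_value[OF F(1)])
    then have "RS_integral_ext ?F g = ?F \<xi> * (g \<infinity> - g (-\<infinity>))"
      by (simp add: algebra_simps)
    then show ?thesis ..
  qed
  then obtain \<xi> where "RS_integral_ext ?F g = ?F \<xi> * (g \<infinity> - g (-\<infinity>))" ..
  \<comment> \<open>With \<open>?F (-\<infinity>) = 0\<close>, collecting the coefficients of
    \<open>g (-\<infinity>)\<close> and \<open>g \<infinity>\<close> leaves \<open>?F \<xi>\<close>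
    and \<open>?F \<infinity> - ?F \<xi>\<close>.\<close>
  then have "AC_integral_mult f g = g (-\<infinity>) * AC_integral f (-\<infinity>) \<xi> + g \<infinity> * AC_integral f \<xi> \<infinity>"
    by (simp add: AC_integral_mult_def AC_integral_def F(2) algebra_simps)
  then show ?thesis ..
qed

end
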